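(* Let $A\in\mathbb{R}^{n_x\times n_x}$, $B\in\mathbb{R}^{n_x\times n_u}$, $C\in\mathbb{R}^{n_y\times n_x}$, and let $\varepsilon\in(0,1)$, $\mu\in[-1,0)$, $\delta\in[1,\infty)$ and an integer $T\ge1$ satisfy $\delta(1+\mu)^{T-1}<\varepsilon$. Suppose $\nu=(X,Y,K_1,K_2,K_3,K_4)$, with $X,Y\in\mathbb{R}^{n_x\times n_x}$ symmetric, $K_1\in\mathbb{R}^{n_x\times n_x}$, $K_2\in\mathbb{R}^{n_x\times n_y}$, $K_3\in\mathbb{R}^{n_u\times n_x}$, $K_4\in\mathbb{R}^{n_u\times n_y}$, satisfies $\mathbf{P}(\nu)\succ0$, $\mathbf{L}(\nu)\succeq0$ and $\tilde{\mathbf{L}}(\nu)\succeq0$ (matrices defined in the context). Let $U,V\in\mathbb{R}^{n_x\times n_x}$ be nonsingular with $VU^\top=I-YX$, put $\mathcal{Y}=\begin{bmatrix} Y & I \\ V^\top & 0 \end{bmatrix}$, and define $$P=\mathcal{Y}^{-\top}\mathbf{P}(\nu)\mathcal{Y}^{-1},\qquad \begin{pmatrix} A_c & B_c \\ C_c & D_c \end{pmatrix}=\begin{pmatrix} U & XB \\ 0 & I_{n_u} \end{pmatrix}^{-1}\begin{pmatrix} K_1-XAY & K_2 \\ K_3 & K_4 \end{pmatrix}\begin{pmatrix} V^\top & 0 \\ CY & I_{n_y} \end{pmatrix}^{-1}.$$ Then, with $F=\begin{bmatrix} A+BD_cC & BC_c \\ B_cC & A_c \end{bmatrix}$ and $H=\begin{bmatrix}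 I_{n_x} & 0 \\ 0 & 0 \end{bmatrix}\in\mathbb{R}^{2n_x\times 2n_x}$, one has $P\succ\epsilon I$ for some $\epsilon\in(0,\infty)$, $F^\top PF\preceq(1+\mu)P$ and $F^\top HPHF\preceq\delta P$; and thus the closed loop of the plant with the resetting controller given by $(A_c,B_c,C_c,D_c)$ and $T$ (defined in the context) is asymptotically stable.
   Context: Matrices depending on $\nu$: $$\mathbf{P}(\nu)=\begin{bmatrix} Y & I \\ I & X \end{bmatrix},\quad \mathbf{F}(\nu)=\begin{bmatrix} AY+BK_3 & A+BK_4C \\ K_1 & XA+K_2C \end{bmatrix},\quad \mathbf{L}(\nu)=\begin{bmatrix} (1+\mu)\mathbf{P}(\nu) & \mathbf{F}(\nu)^\top \\ \mathbf{F}(\nu) & \mathbf{P}(\nu) \end{bmatrix},$$ $$\mathbf{R}(\nu)=\begin{pmatrix} AY+BK_3 & A+BK_4C \end{pmatrix},\quad \tilde{\mathbf{L}}(\nu)=\begin{bmatrix} \delta\mathbf{P}(\nu) & \mathbf{R}(\nu)^\top \\ \mathbf{R}(\nu) & 2I_{n_x}-X \end{bmatrix}.$$ Plant: $x[k+1]=Ax[k]+Bu[k]$, $y[k]=Cx[k]$, $x[0]=x_0$, $k=0,1,2,\dots$. Resetting controller of full order $n_c=n_x$: $x_c[k+1]=A_cx_c[k]+B_cy[k]$ if $(k+1)\bmod T\neq0$, $x_c[k+1]=0$ if $(k+1)\bmod T=0$, $u[k]=C_cx_c[k]+D_cy[k]$, with $x_c[\ell T]=0$ for all $\ell=0,1,2,\dots$.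 Closed-loop state: $z[k]=(x[k]^\top,x_c[k]^\top)^\top$; asymptotic stability is with respect to the origin. $\succ,\succeq,\preceq$ denote the Loewner order on symmetric matrices. The convention $0^0=1$ is used. *)

theory Defs
  imports "HOL-Analysis.Analysis"
begin

subsection \<open>Block matrices and stacked vectors\<close>

definition stack_vec :: "real^'m \<Rightarrow> real^'n \<Rightarrow> real^('m + 'n)" where
  "stack_vec v w = (\<chi> i. case i of Inl a \<Rightarrow> v $ a | Inr b \<Rightarrow> w $ b)"

text \<open>Since \<open>real^'c^'r\<close> is the type of matrices with rows indexed by \<open>'r\<close> and columns by \<open>'c\<close>,
  the arguments below are the blocks in reading order: top left, top right, bottom left, bottom
  right.\<close>

definition block_mat ::
  "real^'c1^'r1 \<Rightarrow> real^'c2^'r1 \<Rightarrow> real^'c1^'r2 \<Rightarrow> real^'c2^'r2 \<Rightarrow> real^('c1 + 'c2)^('r1 + 'r2)" where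
  "block_mat M11 M12 M21 M22 =
     (\<chi> i j. case i of
        Inl a \<Rightarrow> (case j of Inl c \<Rightarrow> M11 $ a $ c | Inr d \<Rightarrow> M12 $ a $ d)
      | Inr b \<Rightarrow> (case j of Inl c \<Rightarrow> M21 $ b $ c | Inr d \<Rightarrow> M22 $ b $ d))"

definition block_row :: "real^'c1^'r \<Rightarrow> real^'c2^'r \<Rightarrow> real^('c1 + 'c2)^'r" where
  "block_row M1 M2 = (\<chi> i j. case j of Inl c \<Rightarrow> M1 $ i $ c | Inr d \<Rightarrow> M2 $ i $ d)"


subsection \<open>Loewner order on symmetric matrices\<close>

text \<open>Both relations include the symmetry of their arguments.\<close>

definition loewner_le :: "real^'n^'n \<Rightarrow> real^'n^'n \<Rightarrow> bool"  (infix "\<preceq>\<^sub>L" 50) where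
  "M \<preceq>\<^sub>L N \<longleftrightarrow> transpose M = M \<and> transpose N = N \<and> (\<forall>v. 0 \<le> v \<bullet> ((N - M) *v v))"

definition loewner_less :: "real^'n^'n \<Rightarrow> real^'n^'n \<Rightarrow> bool"  (infix "\<prec>\<^sub>L" 50) where
  "M \<prec>\<^sub>L N \<longleftrightarrow> transpose M = M \<and> transpose N = N \<and> (\<forall>v. v \<noteq> 0 \<longrightarrow> 0 < v \<bullet> ((N - M) *v v))"


subsection \<open>The matrices depending on \<open>(X, Y, K1, K2, K3, K4)\<close>\<close>

definition P_mat :: "real^'n^'n \<Rightarrow> real^'n^'n \<Rightarrow> real^('n + 'n)^('n + 'n)" where
  "P_mat X Y = block_mat Y (mat 1) (mat 1) X"

definition F_mat ::
  "real^'n^'n \<Rightarrow> real^'u^'n \<Rightarrow> real^'n^'y \<Rightarrow>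
   real^'n^'n \<Rightarrow> real^'n^'n \<Rightarrow> real^'n^'n \<Rightarrow> real^'y^'n \<Rightarrow> real^'n^'u \<Rightarrow> real^'y^'u \<Rightarrow>
   real^('n + 'n)^('n + 'n)" where
  "F_mat A B C X Y K1 K2 K3 K4 =
     block_mat (A ** Y + B ** K3) (A + B ** K4 ** C)
               K1                 (X ** A + K2 ** C)"

definition L_mat ::
  "real \<Rightarrow> real^'n^'n \<Rightarrow> real^'u^'n \<Rightarrow> real^'n^'y \<Rightarrow>
   real^'n^'n \<Rightarrow> real^'n^'n \<Rightarrow> real^'n^'n \<Rightarrow> real^'y^'n \<Rightarrow> real^'n^'u \<Rightarrow> real^'y^'u \<Rightarrow>
   real^(('n + 'n) + ('n + 'n))^(('n + 'n) + ('n + 'n))" where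
  "L_mat \<mu> A B C X Y K1 K2 K3 K4 =
     block_mat ((1 + \<mu>) *\<^sub>R P_mat X Y)        (transpose (F_mat A B C X Y K1 K2 K3 K4))
               (F_mat A B C X Y K1 K2 K3 K4) (P_mat X Y)"

definition R_mat ::
  "real^'n^'n \<Rightarrow> real^'u^'n \<Rightarrow> real^'n^'y \<Rightarrow>
   real^'n^'n \<Rightarrow> real^'n^'u \<Rightarrow> real^'y^'u \<Rightarrow> real^('n + 'n)^'n" where
  "R_mat A B C Y K3 K4 = block_row (A ** Y + B ** K3) (A + B ** K4 ** C)"

definition Ltilde_mat ::
  "real \<Rightarrow> real^'n^'n \<Rightarrow> real^'u^'n \<Rightarrow> real^'n^'y \<Rightarrow>
   real^'n^'n \<Rightarrow> real^'n^'n \<Rightarrow> real^'n^'u \<Rightarrow> real^'y^'u \<Rightarrow>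
   real^(('n + 'n) + 'n)^(('n + 'n) + 'n)" where
  "Ltilde_mat \<delta> A B C X Y K3 K4 =
     block_mat (\<delta> *\<^sub>R P_mat X Y)       (transpose (R_mat A B C Y K3 K4))
               (R_mat A B C Y K3 K4) (2 *\<^sub>R mat 1 - X)"


subsection \<open>Closed loop with the resetting controller\<close>

text \<open>The set of all closed-loop state sequences \<open>z[k] = (x[k], x\<^sub>c[k])\<close>; the plant's initial state
  \<open>x[0]\<close> is arbitrary, whereas \<open>x\<^sub>c[0] = 0\<close> (the case \<open>l = 0\<close> of the last condition).\<close>

definition closed_loop ::
  "real^'n^'n \<Rightarrow> real^'u^'n \<Rightarrow> real^'n^'y \<Rightarrow>
   real^'c^'c \<Rightarrow> real^'y^'c \<Rightarrow> real^'c^'u \<Rightarrow> real^'y^'u \<Rightarrow> nat \<Rightarrow> (nat \<Rightarrow> real^('n + 'c)) set" where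
  "closed_loop A B C Ac Bc Cc Dc T =
     {z. \<exists>x xc u y.
           (\<forall>k. z k = stack_vec (x k) (xc k)) \<and>
           (\<forall>k. x (k + 1) = A *v x k + B *v u k) \<and>
           (\<forall>k. y k = C *v x k) \<and>
           (\<forall>k. (k + 1) mod T \<noteq> 0 \<longrightarrow> xc (k + 1) = Ac *v xc k + Bc *v y k) \<and>
           (\<forall>k. (k + 1) mod T = 0 \<longrightarrow> xc (k + 1) = 0) \<and>
           (\<forall>k. u k = Cc *v xc k + Dc *v y k) \<and>
           (\<forall>l. xc (l * T) = 0)}"

text \<open>Asymptotic stability of the origin for a system given by the set of its trajectories:
  Lyapunov stability, and convergence to the origin. For linear systems, local and global
  attractivity coincide by scaling; the global form is used.\<close>

definition asymptotically_stable :: "(nat \<Rightarrow> 'a::real_normed_vector) set \<Rightarrow> bool" where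
  "asymptotically_stable Z \<longleftrightarrow>
     (\<forall>r>0. \<exists>s>0. \<forall>z\<in>Z. norm (z 0) < s \<longrightarrow> (\<forall>k. norm (z k) < r)) \<and>
     (\<forall>z\<in>Z. z \<longlonglongrightarrow> 0)"

end

theory Submission
  imports Defs
begin

text \<open>With \<open>S = \<Y>\<close>, the change of variables turns the data matrices into congruences:
  \<open>S\<^sup>T P S = P(\<nu>)\<close> and \<open>S\<^sup>T P F S = F(\<nu>)\<close>. This follows from
  \<open>P S = [I, X; 0, U\<^sup>T]\<close>, which is where \<open>V U\<^sup>T = I - Y X\<close> enters. The two matrix
  inequalities are then Schur complements of the assumed ones. They say that \<open>v \<bullet> P v\<close> grows by
  at most the factor \<open>1 + \<mu>\<close> in an ordinary step and \<open>\<delta>\<close> in a reset step, hence by at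
  most \<open>\<delta> (1 + \<mu>)\<^bsup>T-1\<^esup> < 1\<close> over a period.\<close>

section \<open>Block matrices\<close>

lemma sum_UNIV_Plus:
  "(\<Sum>i\<in>(UNIV :: ('a::finite + 'b::finite) set). f i) = (\<Sum>a\<in>UNIV. f (Inl a)) + (\<Sum>b\<in>UNIV. f (Inr b))"
  using sum.Plus[of "UNIV :: 'a set" "UNIV :: 'b set" f] by simp

lemma block_mat_mult:
  "block_mat A B C D ** block_mat A' B' C' D' =
     block_mat (A ** A' + B ** C') (A ** B' + B ** D') (C ** A' + D ** C') (C ** B' + D ** D')"
  by (auto simp: vec_eq_iff block_mat_def matrix_matrix_mult_def sum_UNIV_Plus split: sum.splits)

lemma transpose_block_mat:
  "transpose (block_mat A B C D) = block_mat (transpose A) (transpose C) (transpose B) (transpose D)"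
  by (auto simp: vec_eq_iff block_mat_def transpose_def split: sum.splits)

lemma block_mat_mult_stack_vec:
  "block_mat A B C D *v stack_vec v w = stack_vec (A *v v + B *v w) (C *v v + D *v w)"
  by (auto simp: vec_eq_iff block_mat_def stack_vec_def matrix_vector_mult_def sum_UNIV_Plus
      split: sum.splits)

lemma inner_stack_vec: "stack_vec v w \<bullet> stack_vec v' w' = v \<bullet> v' + w \<bullet> w'"
  by (simp add: inner_vec_def stack_vec_def sum_UNIV_Plus)

lemma block_mat_eq_iff:
  "block_mat A B C D = block_mat A' B' C' D' \<longleftrightarrow> A = A' \<and> B = B' \<and> C = C' \<and> D = D'"
proof
  assume "block_mat A B C D = block_mat A' B' C' D'"
  then have "block_mat A B C D $ i $ j = block_mat A' B' C' D' $ i $ j" for i j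
    by simp
  from this[of "Inl _" "Inl _"] this[of "Inl _" "Inr _"] this[of "Inr _" "Inl _"] this[of "Inr _" "Inr _"]
  show "A = A' \<and> B = B' \<and> C = C' \<and> D = D'"
    by (simp add: vec_eq_iff block_mat_def)
qed simp

lemma mat_1_eq_block_mat: "mat 1 = block_mat (mat 1) 0 0 (mat 1)"
  by (auto simp: vec_eq_iff block_mat_def mat_def split: sum.splits)

lemma stack_vec_cases:
  obtains v w where "z = stack_vec v w"
proof
  show "z = stack_vec (\<chi> i. z $ Inl i) (\<chi> i. z $ Inr i)"
    by (auto simp: vec_eq_iff stack_vec_def split: sum.splits)
qed

lemma block_row_mult_stack_vec: "block_row A B *v stack_vec v w = A *v v + B *v w"
  by (simp add: vec_eq_iff block_row_def stack_vec_def matrix_vector_mult_def sum_UNIV_Plus)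

lemma stack_vec_eq_0_iff: "stack_vec v w = 0 \<longleftrightarrow> v = 0 \<and> w = 0"
  using inner_eq_zero_iff[of "stack_vec v w"]
  by (simp add: inner_stack_vec add_nonneg_eq_0_iff)


section \<open>Matrix algebra\<close>

lemma matrix_add_rdistrib: "(A + B) ** C = A ** C + B ** C"
  for A B :: "real^'n^'m"
  by (simp add: vec_eq_iff matrix_matrix_mult_def sum.distrib algebra_simps)

lemma matrix_mult_zero [simp]: "0 ** A = 0" "B ** 0 = 0"
  for A B :: "real^'n^'m"
  by (simp_all add: vec_eq_iff matrix_matrix_mult_def)

lemma transpose_zero [simp]: "transpose 0 = 0"
  by (simp add: vec_eq_iff transpose_def)

lemma matrix_uminus_mult: "(- A) ** B = - (A ** B)" "A ** (- B) = - (A ** B)"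
  for A :: "real^'n^'m"
  by (simp_all add: vec_eq_iff matrix_matrix_mult_def sum_negf)

lemma matrix_inv_mult:
  assumes "invertible M"
  shows "M ** matrix_inv M = mat 1" "matrix_inv M ** M = mat 1"
  using someI_ex[OF assms[unfolded invertible_def]] by (auto simp: matrix_inv_def)

text \<open>Back substitution gives an explicit right inverse, and for a square matrix a right
  inverse is two-sided.\<close>

lemma invertible_block_mat_upper:
  fixes U :: "real^'n^'n" and B :: "real^'m^'n"
  assumes "invertible U"
  shows "invertible (block_mat U B 0 (mat 1))"
proof -
  have "block_mat U B 0 (mat 1) ** block_mat (matrix_inv U) (- (matrix_inv U ** B)) 0 (mat 1) = mat 1"
    by (simp add: block_mat_mult mat_1_eq_block_mat matrix_uminus_mult matrix_mul_assoc matrix_inv_mult assms)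
  then show ?thesis
    using invertible_right_inverse by blast
qed

lemma invertible_block_mat_lower:
  fixes U :: "real^'n^'n" and C :: "real^'n^'m"
  assumes "invertible U"
  shows "invertible (block_mat U 0 C (mat 1))"
  using transpose_invertible[OF invertible_block_mat_upper[of "transpose U" "transpose C"]]
    transpose_invertible[OF assms]
  by (simp add: transpose_block_mat)

text \<open>This is the shape of \<open>\<Y>\<close>, with \<open>transpose V\<close> as
  \<open>W\<close>; the identity block allows \<open>Y\<close> to be cleared, so the inverse is
  explicit.\<close>

lemma invertible_block_mat_antidiagonal:
  fixes W Y :: "real^'n^'n"
  assumes "invertible W"
  shows "invertible (block_mat Y (mat 1) W 0)"
proof -
  have "block_mat Y (mat 1) W 0 ** block_mat 0 (matrix_inv W) (mat 1) (- (Y ** matrix_inv W)) = mat 1"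
    by (simp add: block_mat_mult mat_1_eq_block_mat matrix_inv_mult assms)
  then show ?thesis
    using invertible_right_inverse by blast
qed

lemma inner_matrix_mult_transpose: "v \<bullet> (transpose M *v w) = (M *v v) \<bullet> w"
  for M :: "real^'n^'m"
  by (metis dot_lmul_matrix transpose_matrix_vector inner_commute)


section \<open>Semidefinite block matrices\<close>

text \<open>The off-diagonal blocks are transposes of each other, so their two contributions at a
  stacked vector coincide; hence the factor 2.\<close>

lemma loewner_le_block_mat:
  assumes "0 \<preceq>\<^sub>L block_mat M (transpose N) N Q"
  shows "0 \<le> v \<bullet> (M *v v) + 2 * (w \<bullet> (N *v v)) + w \<bullet> (Q *v w)"
proof -
  have "0 \<le> stack_vec v w \<bullet> (block_mat M (transpose N) N Q *v stack_vec v w)"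
    using assms by (simp add: loewner_le_def)
  moreover have "v \<bullet> (transpose N *v w) = w \<bullet> (N *v v)"
    by (simp only: inner_matrix_mult_transpose inner_commute)
  ultimately show ?thesis
    by (simp add: block_mat_mult_stack_vec inner_stack_vec inner_add_right del: transpose_matrix_vector)
qed

text \<open>Testing the block inequality at \<open>(S\<^sup>-\<^sup>1 \<xi>, - S\<^sup>-\<^sup>1 F \<xi>)\<close> gives the Schur complement without
  inverting \<open>S\<^sup>T P S\<close>.\<close>

lemma congruence_schur_le:
  fixes P S F :: "real^'n^'n"
  assumes "invertible S" and "transpose P = P"
    and "0 \<preceq>\<^sub>L block_mat (c *\<^sub>R (transpose S ** P ** S)) (transpose (transpose S ** P ** F ** S))
                      (transpose S ** P ** F ** S) (transpose S ** P ** S)"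
  shows "transpose F ** P ** F \<preceq>\<^sub>L c *\<^sub>R P"
  unfolding loewner_le_def
proof (intro conjI allI)
  fix \<xi>
  define v where "v = matrix_inv S *v \<xi>"
  define w where "w = - (matrix_inv S *v (F *v \<xi>))"
  have v: "S *v v = \<xi>"
    by (simp add: v_def matrix_vector_mul_assoc matrix_inv_mult assms(1))
  have w: "S *v w = - (F *v \<xi>)"
    unfolding w_def vec.neg
    by (simp add: matrix_vector_mul_assoc matrix_mul_assoc matrix_inv_mult assms(1))
  have form: "a \<bullet> ((transpose S ** M ** S) *v b) = (S *v a) \<bullet> (M *v (S *v b))" for a b M
    by (simp only: matrix_vector_mul_assoc[symmetric] inner_matrix_mult_transpose)
  \<comment> \<open>The cross term contributes -2 and the last term +1 times the form of
    \<open>P\<close> at \<open>F *v \<xi>\<close>, which leaves -1.\<close>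
  from loewner_le_block_mat[OF assms(3), of v w]
  have "0 \<le> c * (\<xi> \<bullet> (P *v \<xi>)) - (F *v \<xi>) \<bullet> (P *v (F *v \<xi>))"
    using form[of v P v] form[of w P w] form[of w "P ** F" v]
    by (simp add: v w vec.neg matrix_mul_assoc scaleR_matrix_vector_assoc[symmetric]
        flip: matrix_vector_mul_assoc[of P F])
  then show "0 \<le> \<xi> \<bullet> ((c *\<^sub>R P - transpose F ** P ** F) *v \<xi>)"
    by (simp add: matrix_vector_mult_diff_rdistrib inner_diff_right inner_matrix_mult_transpose
        scaleR_matrix_vector_assoc[symmetric]
        flip: matrix_vector_mul_assoc del: transpose_matrix_vector)
qed (use assms(2) in \<open>simp_all add: matrix_transpose_mul transpose_scalar matrix_mul_assoc\<close>)

text \<open>The comparison \<open>2I - X \<preceq> X\<^sup>-\<^sup>1\<close> enters as \<open>(r - X r) \<bullet> X (r - X r) \<ge> 0\<close>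
  with \<open>r = R v\<close>.\<close>

lemma block_mat_two_minus_le:
  fixes X :: "real^'n^'n" and R :: "real^'m^'n"
  assumes "0 \<preceq>\<^sub>L block_mat M (transpose R) R (2 *\<^sub>R mat 1 - X)"
    and "transpose X = X" and psd: "\<And>r. 0 \<le> r \<bullet> (X *v r)"
  shows "(R *v v) \<bullet> (X *v (R *v v)) \<le> v \<bullet> (M *v v)"
proof -
  define r where "r = R *v v"
  have sym: "(X *v a) \<bullet> b = a \<bullet> (X *v b)" for a b
    using inner_matrix_mult_transpose[of a X b] assms(2) by simp
  \<comment> \<open>With \<open>- (X *v r)\<close> as second component, the terms of degree two and
    three in \<open>X\<close> are the negatives of those in the next inequality; the sum keeps only
    \<open>v \<bullet> (M *v v) - r \<bullet> (X *v r)\<close>.\<close>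
  have 1: "0 \<le> v \<bullet> (M *v v) - 2 * (r \<bullet> (X *v r)) + 2 * ((X *v r) \<bullet> (X *v r))
      - (X *v r) \<bullet> (X *v (X *v r))"
    using loewner_le_block_mat[OF assms(1), of v "- (X *v r)"]
    by (simp add: r_def[symmetric] vec.neg matrix_vector_mult_diff_rdistrib inner_diff_right
        scaleR_matrix_vector_assoc[symmetric] inner_commute)
  have "0 \<le> r \<bullet> (X *v r) - 2 * ((X *v r) \<bullet> (X *v r)) + (X *v r) \<bullet> (X *v (X *v r))"
    using psd[of "r - X *v r"]
    by (simp add: matrix_vector_mult_diff_distrib inner_diff_left inner_diff_right sym[of r])
  with 1 show ?thesis
    by (simp add: r_def)
qed


section \<open>Quadratic Lyapunov functions\<close>

text \<open>The form attains its minimum on the compact unit sphere, where it is positive;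
  homogeneity of degree two carries the bound to all vectors.\<close>

lemma loewner_less_scaled_identity:
  fixes P :: "real^'n^'n"
  assumes "0 \<prec>\<^sub>L P"
  shows "\<exists>e>0. e *\<^sub>R mat 1 \<prec>\<^sub>L P"
proof -
  let ?S = "sphere (0 :: real^'n) 1"
  have "continuous_on ?S (\<lambda>v. v \<bullet> (P *v v))"
    by (intro continuous_intros)
  moreover have "axis undefined 1 \<in> ?S"
    by simp
  ultimately obtain u where u: "norm u = 1" "\<And>v. norm v = 1 \<Longrightarrow> u \<bullet> (P *v u) \<le> v \<bullet> (P *v v)"
    using continuous_attains_inf[of ?S "\<lambda>v. v \<bullet> (P *v v)"] by fastforce
  define m where "m = u \<bullet> (P *v u)"
  have "m > 0"
    using assms u(1) norm_eq_zero[of u] by (auto simp: loewner_less_def m_def)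
  have "m * (v \<bullet> v) \<le> v \<bullet> (P *v v)" for v
  proof (cases "v = 0")
    case False
    have "m \<le> (v /\<^sub>R norm v) \<bullet> (P *v (v /\<^sub>R norm v))"
      using u(2)[of "v /\<^sub>R norm v"] False by (simp add: m_def)
    also have "\<dots> = v \<bullet> (P *v v) / (v \<bullet> v)"
      by (simp add: matrix_vector_mult_scaleR divide_simps dot_square_norm power2_eq_square)
    finally show ?thesis
      using False by (simp add: field_simps)
  qed simp
  \<comment> \<open>Half the minimum is taken because \<open>\<prec>\<^sub>L\<close> demands a
    strict inequality, also where the minimum is attained.\<close>
  moreover have "v \<noteq> 0 \<Longrightarrow> (m / 2) * (v \<bullet> v) < m * (v \<bullet> v)" for v :: "real^'n"
    using \<open>m > 0\<close> by simp
  ultimately have "v \<noteq> 0 \<Longrightarrow> (m / 2) * (v \<bullet> v) < v \<bullet> (P *v v)" for v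
    by (meson less_le_trans)
  then have "(m / 2) *\<^sub>R mat 1 \<prec>\<^sub>L P"
    using assms
    by (simp add: loewner_less_def transpose_scalar matrix_vector_mult_diff_rdistrib inner_diff_right
        scaleR_matrix_vector_assoc[symmetric])
  with \<open>m > 0\<close> show ?thesis
    by (metis half_gt_zero)
qed

lemma quadratic_form_le_norm:
  fixes P :: "real^'n^'n"
  shows "\<exists>M>0. \<forall>v. v \<bullet> (P *v v) \<le> M * (norm v)\<^sup>2"
proof -
  obtain K where K: "K > 0" "\<And>v. norm (P *v v) \<le> norm v * K"
    using bounded_linear.pos_bounded[of "(*v) P"] by auto
  have "v \<bullet> (P *v v) \<le> K * (norm v)\<^sup>2" for v
  proof -
    have "v \<bullet> (P *v v) \<le> norm v * norm (P *v v)"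
      by (rule norm_cauchy_schwarz)
    also have "\<dots> \<le> norm v * (norm v * K)"
      by (intro mult_left_mono K) simp
    finally show ?thesis
      by (simp add: power2_eq_square mult_ac)
  qed
  with K(1) show ?thesis
    by blast
qed

text \<open>Up to time \<open>k\<close> there are \<open>k div T\<close> full periods, each with
  \<open>T - 1\<close> ordinary steps and one reset, and then \<open>k mod T\<close> ordinary steps.
  For \<open>a = 0\<close> the convention \<open>0 ^ 0 = 1\<close> keeps the bound right just after
  a reset.\<close>

lemma periodic_growth_bound:
  fixes W :: "nat \<Rightarrow> real"
  assumes "0 \<le> a" "0 \<le> d" "0 < T"
    and step: "\<And>k. Suc k mod T \<noteq> 0 \<Longrightarrow> W (Suc k) \<le> a * W k"
    and reset: "\<And>k. Suc k mod T = 0 \<Longrightarrow> W (Suc k) \<le> d * W k"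
  shows "W k \<le> (d * a ^ (T - 1)) ^ (k div T) * a ^ (k mod T) * W 0"
proof (induction k)
  case (Suc k)
  let ?q = "d * a ^ (T - 1)"
  show ?case
  proof (cases "Suc k mod T = 0")
    case True
    \<comment> \<open>At a reset the accumulated power \<open>a ^ (T - 1)\<close> and the new
      \<open>d\<close> complete one factor \<open>?q\<close>, and the exponent of \<open>a\<close>
      returns to 0.\<close>
    then have km: "k mod T = T - 1"
      using mod_Suc[of k T] by (auto split: if_splits)
    have kd: "Suc k div T = Suc (k div T)"
      using True div_Suc[of k T] by simp
    have "W (Suc k) \<le> d * (?q ^ (k div T) * a ^ (k mod T) * W 0)"
      by (rule order_trans[OF reset[OF True] mult_left_mono[OF Suc \<open>0 \<le> d\<close>]])
    also have "\<dots> = ?q ^ (Suc k div T) * a ^ (Suc k mod T) * W 0"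
      unfolding kd True km by simp
    finally show ?thesis .
  next
    case False
    then have km: "Suc k mod T = Suc (k mod T)"
      by (simp add: mod_Suc split: if_splits)
    have kd: "Suc k div T = k div T"
      using False by (simp add: div_Suc)
    have "W (Suc k) \<le> a * (?q ^ (k div T) * a ^ (k mod T) * W 0)"
      by (rule order_trans[OF step[OF False] mult_left_mono[OF Suc \<open>0 \<le> a\<close>]])
    also have "\<dots> = ?q ^ (Suc k div T) * a ^ (Suc k mod T) * W 0"
      unfolding kd km by simp
    finally show ?thesis .
  qed
qed simp

text \<open>The form of \<open>P\<close> lies between multiples of the squared norm. It may grow at
  a single reset, but it contracts over each full period, and this is enough for both stability and
  convergence.\<close>

lemma asymptotically_stable_periodic_lyapunov:
  fixes P :: "real^'n^'n" and Z :: "(nat \<Rightarrow> real^'n) set"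
  assumes "0 < e" and "e *\<^sub>R mat 1 \<prec>\<^sub>L P"
    and "0 \<le> a" "a \<le> 1" "0 \<le> d" "0 < T" "d * a ^ (T - 1) < 1"
    and step: "\<And>z k. z \<in> Z \<Longrightarrow> Suc k mod T \<noteq> 0 \<Longrightarrow> z (Suc k) \<bullet> (P *v z (Suc k)) \<le> a * (z k \<bullet> (P *v z k))"
    and reset: "\<And>z k. z \<in> Z \<Longrightarrow> Suc k mod T = 0 \<Longrightarrow> z (Suc k) \<bullet> (P *v z (Suc k)) \<le> d * (z k \<bullet> (P *v z k))"
  shows "asymptotically_stable Z"
proof -
  define q where "q = d * a ^ (T - 1)"
  have q: "0 \<le> q" "q < 1"
    using assms by (simp_all add: q_def)
  have lower: "e * (norm v)\<^sup>2 \<le> v \<bullet> (P *v v)" for v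
  proof (cases "v = 0")
    case False
    then have "0 < v \<bullet> ((P - e *\<^sub>R mat 1) *v v)"
      using assms(2) unfolding loewner_less_def by blast
    then show ?thesis
      by (simp add: matrix_vector_mult_diff_rdistrib inner_diff_right dot_square_norm
          scaleR_matrix_vector_assoc[symmetric])
  qed simp
  obtain M where M: "M > 0" "\<And>v. v \<bullet> (P *v v) \<le> M * (norm v)\<^sup>2"
    using quadratic_form_le_norm by blast
  have bound: "e * (norm (z k))\<^sup>2 \<le> q ^ (k div T) * (M * (norm (z 0))\<^sup>2)" if "z \<in> Z" for z k
  proof -
    have nonneg: "0 \<le> z 0 \<bullet> (P *v z 0)"
      using lower[of "z 0"] \<open>0 < e\<close> by (meson less_imp_le mult_nonneg_nonneg order_trans zero_le_power2)
    have "e * (norm (z k))\<^sup>2 \<le> z k \<bullet> (P *v z k)"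
      by (rule lower)
    also have "\<dots> \<le> q ^ (k div T) * a ^ (k mod T) * (z 0 \<bullet> (P *v z 0))"
      unfolding q_def
      by (rule periodic_growth_bound[where W = "\<lambda>k. z k \<bullet> (P *v z k)"])
        (use assms that in auto)
    \<comment> \<open>As \<open>a \<le> 1\<close>, the incomplete last period can only decrease the
      bound.\<close>
    also have "\<dots> \<le> q ^ (k div T) * 1 * (z 0 \<bullet> (P *v z 0))"
      using assms q nonneg by (intro mult_right_mono mult_left_mono power_le_one) auto
    also have "\<dots> \<le> q ^ (k div T) * (M * (norm (z 0))\<^sup>2)"
      using M(2) q by (simp add: mult_left_mono)
    finally show ?thesis .
  qed
  show ?thesis
    unfolding asymptotically_stable_def
  proof (intro conjI allI impI ballI)
    fix r :: real
    assume "r > 0"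
    show "\<exists>s>0. \<forall>z\<in>Z. norm (z 0) < s \<longrightarrow> (\<forall>k. norm (z k) < r)"
    \<comment> \<open>The radius \<open>s\<close> solves
      \<open>M * s\<^sup>2 = e * r\<^sup>2\<close>, which matches the upper bound at time 0 with the
      lower bound at time \<open>k\<close>.\<close>
    proof (intro exI[of _ "r * sqrt (e / M)"] conjI ballI impI allI)
      show "0 < r * sqrt (e / M)"
        using \<open>r > 0\<close> \<open>e > 0\<close> M(1) by simp
      fix z k
      assume "z \<in> Z" and small: "norm (z 0) < r * sqrt (e / M)"
      have "e * (norm (z k))\<^sup>2 \<le> q ^ (k div T) * (M * (norm (z 0))\<^sup>2)"
        by (rule bound[OF \<open>z \<in> Z\<close>])
      also have "\<dots> \<le> 1 * (M * (norm (z 0))\<^sup>2)"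
        using q M(1) by (intro mult_right_mono power_le_one) auto
      also have "(norm (z 0))\<^sup>2 < (r * sqrt (e / M))\<^sup>2"
        using small by (intro power_strict_mono) auto
      also have "(r * sqrt (e / M))\<^sup>2 = r\<^sup>2 * (e / M)"
        using \<open>e > 0\<close> M(1) by (simp add: power_mult_distrib)
      finally have "e * (norm (z k))\<^sup>2 < e * r\<^sup>2"
        using M(1) by (simp add: mult_ac)
      then show "norm (z k) < r"
        using \<open>e > 0\<close> \<open>r > 0\<close> by (simp add: power_less_imp_less_base)
    qed
  next
    fix z
    assume "z \<in> Z"
    have "(\<lambda>k. q ^ (k div T)) \<longlonglongrightarrow> 0"
      using q \<open>0 < T\<close> by (intro filterlim_compose[OF LIMSEQ_power_zero filterlim_at_top_div_const_nat]) auto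
    then have lim: "(\<lambda>k. q ^ (k div T) * (M * (norm (z 0))\<^sup>2) / e) \<longlonglongrightarrow> 0"
      using \<open>e > 0\<close> by (auto intro!: tendsto_eq_intros)
    have "(\<lambda>k. (norm (z k))\<^sup>2) \<longlonglongrightarrow> 0"
    proof (rule tendsto_sandwich[OF _ _ tendsto_const lim])
      show "\<forall>\<^sub>F k in sequentially. (norm (z k))\<^sup>2 \<le> q ^ (k div T) * (M * (norm (z 0))\<^sup>2) / e"
        using bound[OF \<open>z \<in> Z\<close>] \<open>e > 0\<close> by (simp add: pos_le_divide_eq mult.commute)
    qed simp
    from tendsto_real_sqrt[OF this] show "z \<longlonglongrightarrow> 0"
      by (simp add: tendsto_norm_zero_iff)
  qed
qed


section \<open>The closed loop\<close>

text \<open>Eliminating \<open>u\<close> and \<open>y\<close> gives \<open>F\<close>. At a reset the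
  plant state still makes its ordinary step and only the controller state is cleared, so the
  projection onto the plant state follows \<open>F\<close>.\<close>

lemma closed_loop_step:
  fixes A :: "real^'n^'n" and B :: "real^'u^'n" and C :: "real^'n^'y"
    and Ac :: "real^'c^'c" and Bc :: "real^'y^'c" and Cc :: "real^'c^'u" and Dc :: "real^'y^'u"
  assumes "z \<in> closed_loop A B C Ac Bc Cc Dc T"
    and "F = block_mat (A + B ** Dc ** C) (B ** Cc) (Bc ** C) Ac"
  shows "Suc k mod T \<noteq> 0 \<Longrightarrow> z (Suc k) = F *v z k"
    and "Suc k mod T = 0 \<Longrightarrow> z (Suc k) = block_mat (mat 1) 0 0 0 *v (F *v z k)"
proof -
  obtain x xc u y where eqs:
    "\<And>k. z k = stack_vec (x k) (xc k)"
    "\<And>k. x (Suc k) = A *v x k + B *v u k"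
    "\<And>k. y k = C *v x k"
    "\<And>k. Suc k mod T \<noteq> 0 \<Longrightarrow> xc (Suc k) = Ac *v xc k + Bc *v y k"
    "\<And>k. Suc k mod T = 0 \<Longrightarrow> xc (Suc k) = 0"
    "\<And>k. u k = Cc *v xc k + Dc *v y k"
    using assms(1) by (auto simp: closed_loop_def)
  show "z (Suc k) = F *v z k" if "Suc k mod T \<noteq> 0"
    using eqs(4)[OF that] unfolding eqs(1,2,3,6) assms(2)
    by (simp add: block_mat_mult_stack_vec algebra_simps matrix_vector_mul_assoc matrix_mul_assoc)
  show "z (Suc k) = block_mat (mat 1) 0 0 0 *v (F *v z k)" if "Suc k mod T = 0"
    using eqs(5)[OF that] unfolding eqs(1,2,3,6) assms(2)
    by (simp add: block_mat_mult_stack_vec algebra_simps matrix_vector_mul_assoc matrix_mul_assoc)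
qed

theorem theorem2:
  fixes A :: "real^'n^'n" and B :: "real^'u^'n" and C :: "real^'n^'y"
    and \<epsilon> \<mu> \<delta> :: real and T :: nat
    and X Y K1 :: "real^'n^'n" and K2 :: "real^'y^'n" and K3 :: "real^'n^'u" and K4 :: "real^'y^'u"
    and U V :: "real^'n^'n"
    and \<Y> P F H :: "real^('n + 'n)^('n + 'n)"
    and Ac :: "real^'n^'n" and Bc :: "real^'y^'n" and Cc :: "real^'n^'u" and Dc :: "real^'y^'u"
  assumes "\<epsilon> \<in> {0<..<1}" and "\<mu> \<in> {-1..<0}" and "\<delta> \<in> {1..}" and "T \<ge> 1"
    and "\<delta> * (1 + \<mu>) ^ (T - 1) < \<epsilon>"
    and "transpose X = X" and "transpose Y = Y"
    and "0 \<prec>\<^sub>L P_mat X Y"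
    and "0 \<preceq>\<^sub>L L_mat \<mu> A B C X Y K1 K2 K3 K4"
    and "0 \<preceq>\<^sub>L Ltilde_mat \<delta> A B C X Y K3 K4"
    and "invertible U" and "invertible V"
    and "V ** transpose U = mat 1 - Y ** X"
    and "\<Y> = block_mat Y (mat 1) (transpose V) 0"
    and "P = transpose (matrix_inv \<Y>) ** P_mat X Y ** matrix_inv \<Y>"
    and "block_mat Ac Bc Cc Dc =
           matrix_inv (block_mat U (X ** B) 0 (mat 1))
             ** block_mat (K1 - X ** A ** Y) K2 K3 K4
             ** matrix_inv (block_mat (transpose V) 0 (C ** Y) (mat 1))"
    and "F = block_mat (A + B ** Dc ** C) (B ** Cc) (Bc ** C) Ac"
    and "H = block_mat (mat 1) 0 0 0"
  shows "(\<exists>e>0. e *\<^sub>R mat 1 \<prec>\<^sub>L P)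
       \<and> transpose F ** P ** F \<preceq>\<^sub>L (1 + \<mu>) *\<^sub>R P
       \<and> transpose F ** H ** P ** H ** F \<preceq>\<^sub>L \<delta> *\<^sub>R P
       \<and> asymptotically_stable (closed_loop A B C Ac Bc Cc Dc T)"
proof -

  \<comment> \<open>Congruence by \<open>\<Y>\<close>\<close>
  define Pn where "Pn = P_mat X Y"
  define Z where "Z = block_mat (mat 1) X 0 (transpose U)"
  note [simp] = \<open>transpose X = X\<close> \<open>transpose Y = Y\<close>
  have inv: "invertible \<Y>"
    unfolding \<open>\<Y> = _\<close>
    by (intro invertible_block_mat_antidiagonal transpose_invertible \<open>invertible V\<close>)
  have inv_tr: "transpose \<Y> ** transpose (matrix_inv \<Y>) = mat 1"
    by (simp add: matrix_transpose_mul[symmetric] matrix_inv_mult inv)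
  have Pn_sym: "transpose Pn = Pn"
    by (simp add: Pn_def P_mat_def transpose_block_mat)
  then have P_sym: "transpose P = P"
    unfolding \<open>P = _\<close> Pn_def by (simp add: matrix_transpose_mul matrix_mul_assoc)
  have YtPY: "transpose \<Y> ** P ** \<Y> = Pn"
  proof -
    have "transpose \<Y> ** P ** \<Y>
        = (transpose \<Y> ** transpose (matrix_inv \<Y>)) ** Pn ** (matrix_inv \<Y> ** \<Y>)"
      unfolding \<open>P = _\<close> Pn_def by (simp add: matrix_mul_assoc)
    then show ?thesis
      by (simp add: inv_tr matrix_inv_mult inv)
  qed
  \<comment> \<open>The top right block is \<open>Y ** X + V ** transpose U\<close>, which equals
    the identity by the choice of \<open>U\<close> and \<open>V\<close>.\<close>
  have "transpose \<Y> ** Z = Pn"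
    using \<open>V ** transpose U = mat 1 - Y ** X\<close>
    by (simp add: \<open>\<Y> = _\<close> Z_def Pn_def P_mat_def transpose_block_mat block_mat_mult)
  then have "(transpose (matrix_inv \<Y>) ** transpose \<Y>) ** (P ** \<Y>)
      = (transpose (matrix_inv \<Y>) ** transpose \<Y>) ** Z"
    using YtPY by (metis matrix_mul_assoc)
  then have PY: "P ** \<Y> = Z"
    using matrix_left_right_inverse[THEN iffD1, OF inv_tr] by simp
  have YtP: "transpose \<Y> ** P = transpose Z"
    using arg_cong[OF PY, of transpose] by (simp add: matrix_transpose_mul P_sym)

  \<comment> \<open>Clearing the two inverses from the controller formula and comparing blocks
    expresses \<open>K1\<close> to \<open>K4\<close> through the controller matrices.\<close>
  have "block_mat U (X ** B) 0 (mat 1) ** block_mat Ac Bc Cc Dc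
          ** block_mat (transpose V) 0 (C ** Y) (mat 1)
        = block_mat (K1 - X ** A ** Y) K2 K3 K4"
  proof -
    let ?L = "block_mat U (X ** B) 0 (mat 1)" and ?R = "block_mat (transpose V) 0 (C ** Y) (mat 1)"
    let ?K = "block_mat (K1 - X ** A ** Y) K2 K3 K4"
    have "invertible ?L" "invertible ?R"
      using \<open>invertible U\<close> \<open>invertible V\<close>
      by (auto intro: invertible_block_mat_upper invertible_block_mat_lower transpose_invertible)
    then have "(?L ** matrix_inv ?L) ** ?K ** (matrix_inv ?R ** ?R) = ?K"
      by (simp add: matrix_inv_mult)
    then show ?thesis
      unfolding \<open>block_mat Ac Bc Cc Dc = _\<close> by (simp only: matrix_mul_assoc)
  qed
  then have K: "K1 = X ** A ** Y + ((U ** Ac + X ** B ** Cc) ** transpose V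
                  + (U ** Bc + X ** B ** Dc) ** (C ** Y))"
      "K2 = U ** Bc + X ** B ** Dc" "K3 = Cc ** transpose V + Dc ** (C ** Y)" "K4 = Dc"
    by (auto simp: block_mat_mult block_mat_eq_iff eq_diff_eq add.commute)
  \<comment> \<open>The upper block row is \<open>R_mat A B C Y K3 K4\<close>; the reset inequality
    will use just this row.\<close>
  have FY: "F ** \<Y> = block_mat (A ** Y + B ** K3) (A + B ** K4 ** C)
      (Bc ** C ** Y + Ac ** transpose V) (Bc ** C)"
    by (simp add: \<open>F = _\<close> \<open>\<Y> = _\<close> block_mat_mult K matrix_add_ldistrib matrix_add_rdistrib
        matrix_mul_assoc add_ac)
  have YtPFY: "transpose \<Y> ** P ** F ** \<Y> = F_mat A B C X Y K1 K2 K3 K4"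
  proof -
    \<comment> \<open>\<open>transpose Z\<close> keeps the upper block row and replaces the lower
      one by \<open>X\<close> times the upper plus \<open>U\<close> times the lower, which produces
      \<open>K1\<close> and \<open>X ** A + K2 ** C\<close>.\<close>
    have "transpose \<Y> ** P ** F ** \<Y> = transpose Z ** (F ** \<Y>)"
      by (simp only: YtP[symmetric] matrix_mul_assoc)
    also have "\<dots> = F_mat A B C X Y K1 K2 K3 K4"
      unfolding FY Z_def transpose_block_mat block_mat_mult F_mat_def block_mat_eq_iff K
      by (simp add: matrix_add_ldistrib matrix_add_rdistrib matrix_mul_assoc add_ac)
    finally show ?thesis .
  qed

  \<comment> \<open>Positivity of \<open>P\<close> and the two Lyapunov inequalities\<close>
  have P_pos: "0 \<prec>\<^sub>L P"
    unfolding loewner_less_def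
  proof (intro conjI allI impI)
    fix v :: "real^('n + 'n)"
    assume "v \<noteq> 0"
    then have "matrix_inv \<Y> *v v \<noteq> 0"
      by (metis inv matrix_inv_mult(1) matrix_vector_mul_assoc matrix_vector_mul_lid matrix_vector_mult_0_right)
    then have "0 < (matrix_inv \<Y> *v v) \<bullet> (Pn *v (matrix_inv \<Y> *v v))"
      using \<open>0 \<prec>\<^sub>L P_mat X Y\<close> by (simp add: loewner_less_def Pn_def)
    then show "0 < v \<bullet> ((P - 0) *v v)"
      unfolding \<open>P = _\<close> Pn_def
      by (simp add: inner_matrix_mult_transpose flip: matrix_vector_mul_assoc
          del: transpose_matrix_vector)
  qed (simp_all add: P_sym)
  then obtain e where e: "e > 0" "e *\<^sub>R mat 1 \<prec>\<^sub>L P"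
    using loewner_less_scaled_identity by blast

  have step: "transpose F ** P ** F \<preceq>\<^sub>L (1 + \<mu>) *\<^sub>R P"
    using \<open>0 \<preceq>\<^sub>L L_mat \<mu> A B C X Y K1 K2 K3 K4\<close>
    by (intro congruence_schur_le[OF inv P_sym])
      (simp add: YtPY YtPFY L_mat_def Pn_def[symmetric])

  \<comment> \<open>\<open>X\<close> is a diagonal block of \<open>P_mat X Y\<close>, tested here by
    vectors with vanishing first component.\<close>
  have X_psd: "0 \<le> r \<bullet> (X *v r)" for r
  proof (cases "r = 0")
    case False
    then have "0 < stack_vec 0 r \<bullet> (P_mat X Y *v stack_vec 0 r)"
      using \<open>0 \<prec>\<^sub>L P_mat X Y\<close> by (auto simp: loewner_less_def stack_vec_eq_0_iff)
    then show ?thesis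
      by (simp add: P_mat_def block_mat_mult_stack_vec inner_stack_vec)
  qed simp
  \<comment> \<open>The projected vector is the image under \<open>\<Y>\<close> of
    \<open>stack_vec 0 x\<close>, so the congruence leaves only the lower right block
    \<open>X\<close> of \<open>Pn\<close>.\<close>
  have H_form: "(H *v z) \<bullet> (P *v (H *v z)) = x \<bullet> (X *v x)" if "z = stack_vec x x'" for z x x'
  proof -
    have "H *v z = \<Y> *v stack_vec 0 x"
      by (simp add: that \<open>H = _\<close> \<open>\<Y> = _\<close> block_mat_mult_stack_vec)
    moreover have "(\<Y> *v w) \<bullet> (P *v (\<Y> *v w)) = w \<bullet> (Pn *v w)" for w
      by (simp only: YtPY[symmetric] matrix_vector_mul_assoc[symmetric] inner_matrix_mult_transpose)
    ultimately show ?thesis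
      by (simp add: Pn_def P_mat_def block_mat_mult_stack_vec inner_stack_vec)
  qed
  have reset: "transpose F ** H ** P ** H ** F \<preceq>\<^sub>L \<delta> *\<^sub>R P"
    unfolding loewner_le_def
  proof (intro conjI allI)
    have H_sym: "transpose H = H"
      by (simp add: \<open>H = _\<close> transpose_block_mat)
    then show "transpose (transpose F ** H ** P ** H ** F) = transpose F ** H ** P ** H ** F"
      by (simp add: matrix_transpose_mul P_sym matrix_mul_assoc)
    show "transpose (\<delta> *\<^sub>R P) = \<delta> *\<^sub>R P"
      by (simp add: transpose_scalar P_sym)
    fix \<xi> :: "real^('n + 'n)"
    define v where "v = matrix_inv \<Y> *v \<xi>"
    have v: "\<Y> *v v = \<xi>"
      by (simp add: v_def matrix_vector_mul_assoc matrix_inv_mult inv)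
    obtain v1 v2 where v12: "v = stack_vec v1 v2"
      by (rule stack_vec_cases)
    have "F *v \<xi> = stack_vec (R_mat A B C Y K3 K4 *v v) ((Bc ** C ** Y + Ac ** transpose V) *v v1 + (Bc ** C) *v v2)"
      unfolding v[symmetric] matrix_vector_mul_assoc FY
      by (simp add: v12 R_mat_def block_row_mult_stack_vec block_mat_mult_stack_vec)
    then have "(H *v (F *v \<xi>)) \<bullet> (P *v (H *v (F *v \<xi>)))
        = (R_mat A B C Y K3 K4 *v v) \<bullet> (X *v (R_mat A B C Y K3 K4 *v v))"
      by (rule H_form)
    also have "\<dots> \<le> v \<bullet> ((\<delta> *\<^sub>R Pn) *v v)"
      using \<open>0 \<preceq>\<^sub>L Ltilde_mat \<delta> A B C X Y K3 K4\<close>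
      by (intro block_mat_two_minus_le X_psd) (simp_all add: Ltilde_mat_def Pn_def)
    also have "\<dots> = \<delta> * (\<xi> \<bullet> (P *v \<xi>))"
      unfolding YtPY[symmetric] v[symmetric]
      by (simp add: scaleR_matrix_vector_assoc[symmetric] inner_matrix_mult_transpose
          flip: matrix_vector_mul_assoc del: transpose_matrix_vector)
    finally have "0 \<le> \<delta> * (\<xi> \<bullet> (P *v \<xi>)) - \<xi> \<bullet> (transpose F *v (transpose H *v (P *v (H *v (F *v \<xi>)))))"
      by (simp only: inner_matrix_mult_transpose)
    then show "0 \<le> \<xi> \<bullet> ((\<delta> *\<^sub>R P - transpose F ** H ** P ** H ** F) *v \<xi>)"
      by (simp add: matrix_vector_mult_diff_rdistrib inner_diff_right H_sym
          scaleR_matrix_vector_assoc[symmetric]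
          flip: matrix_vector_mul_assoc del: transpose_matrix_vector)
  qed

  \<comment> \<open>Asymptotic stability\<close>
  have step_form: "(F *v \<xi>) \<bullet> (P *v (F *v \<xi>)) \<le> (1 + \<mu>) * (\<xi> \<bullet> (P *v \<xi>))" for \<xi>
  proof -
    have "0 \<le> \<xi> \<bullet> (((1 + \<mu>) *\<^sub>R P - transpose F ** P ** F) *v \<xi>)"
      using step by (simp add: loewner_le_def)
    then show ?thesis
      by (simp add: matrix_vector_mult_diff_rdistrib inner_diff_right inner_matrix_mult_transpose
          scaleR_matrix_vector_assoc[symmetric]
          flip: matrix_vector_mul_assoc del: transpose_matrix_vector)
  qed
  have reset_form: "(H *v (F *v \<xi>)) \<bullet> (P *v (H *v (F *v \<xi>))) \<le> \<delta> * (\<xi> \<bullet> (P *v \<xi>))" for \<xi>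
  proof -
    \<comment> \<open>The left \<open>H\<close> is written as its transpose so that it moves to the
      other side of the inner product.\<close>
    have "0 \<le> \<xi> \<bullet> ((\<delta> *\<^sub>R P - transpose F ** transpose H ** P ** H ** F) *v \<xi>)"
      using reset by (simp add: loewner_le_def \<open>H = _\<close> transpose_block_mat)
    then show ?thesis
      by (simp add: matrix_vector_mult_diff_rdistrib inner_diff_right inner_matrix_mult_transpose
          scaleR_matrix_vector_assoc[symmetric]
          flip: matrix_vector_mul_assoc del: transpose_matrix_vector)
  qed
  have "asymptotically_stable (closed_loop A B C Ac Bc Cc Dc T)"
  \<comment> \<open>The period factor \<open>\<delta> * (1 + \<mu>) ^ (T - 1)\<close> is below
    \<open>\<epsilon>\<close>, hence below 1.\<close>
  proof (rule asymptotically_stable_periodic_lyapunov[OF e, where a = "1 + \<mu>" and d = \<delta> and T = T])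
    fix z k
    assume z: "z \<in> closed_loop A B C Ac Bc Cc Dc T"
    note closed = closed_loop_step[OF z \<open>F = _\<close>]
    show "z (Suc k) \<bullet> (P *v z (Suc k)) \<le> (1 + \<mu>) * (z k \<bullet> (P *v z k))" if "Suc k mod T \<noteq> 0"
      unfolding closed(1)[OF that] by (rule step_form)
    show "z (Suc k) \<bullet> (P *v z (Suc k)) \<le> \<delta> * (z k \<bullet> (P *v z k))" if "Suc k mod T = 0"
      unfolding closed(2)[OF that] \<open>H = _\<close>[symmetric] by (rule reset_form)
  qed (use assms(1-5) in auto)
  with e step reset show ?thesis
    by blast
qed

end
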